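(* Let $\mathbb{F}$ be a field, let $n\geq 4$, and let $A\in\mathbb{F}^{n\times n}$ be an irreducible matrix. Then every matrix in the fiber of $A$ is irreducible.
   Context: The fiber of $A\in\mathbb{F}^{n\times n}$ (under the principal minor map) is the set of all $B\in\mathbb{F}^{n\times n}$ with $\det B[S,S]=\det A[S,S]$ for all $S\subseteq\{1,\dots,n\}$, where $A[S,S]$ is the principal submatrix indexed by $S$. A matrix is reducible if, after permuting some rows and the corresponding columns by the same permutation, it is block upper triangular with at least two (square, nonempty) diagonal blocks; otherwise it is irreducible. *)

theory Defs
  imports
    "HOL-Combinatorics.Permutations"
    "Jordan_Normal_Form.Determinant"
    "Jordan_Normal_Form.DL_Submatrix"
begin

(* Rows and columns of a matrix are indexed from 0, so the index set of an n x n matrix is {0..<n}. *)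

(* The determinant of the empty submatrix is 1, so S = {} imposes no condition. *)
definition principal_minor :: "'a::comm_ring_1 mat \<Rightarrow> nat set \<Rightarrow> 'a" where
  "principal_minor A S = det (submatrix A S S)"

definition fiber :: "nat \<Rightarrow> 'a::comm_ring_1 mat \<Rightarrow> 'a mat set" where
  "fiber n A = {B \<in> carrier_mat n n. \<forall>S \<subseteq> {0..<n}. principal_minor B S = principal_minor A S}"

(* ds lists the sizes of the square diagonal blocks from top to bottom.  An entry (i, j) lies
   strictly below the diagonal blocks iff some block boundary b satisfies j < b <= i. *)
definition block_upper_triangular :: "nat list \<Rightarrow> 'a::zero mat \<Rightarrow> bool" where
  "block_upper_triangular ds A \<longleftrightarrow>
     A \<in> carrier_mat (sum_list ds) (sum_list ds) \<and> (\<forall>d \<in> set ds. d > 0) \<and>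
     (\<forall>i < dim_row A. \<forall>j < dim_col A.
        (\<exists>k \<le> length ds. j < sum_list (take k ds) \<and> sum_list (take k ds) \<le> i) \<longrightarrow> A $$ (i, j) = 0)"

definition reducible_mat :: "'a::zero mat \<Rightarrow> bool" where
  "reducible_mat A \<longleftrightarrow>
     square_mat A \<and>
     (\<exists>p ds. p permutes {0..<dim_row A} \<and> length ds \<ge> 2 \<and>
        block_upper_triangular ds
          (mat (dim_row A) (dim_row A) (\<lambda>(i, j). A $$ (p i, p j))))"

definition irreducible_mat :: "'a::zero mat \<Rightarrow> bool" where
  "irreducible_mat A \<longleftrightarrow> square_mat A \<and> \<not> reducible_mat A"

end

theory Submission
  imports Defs
begin

text \<open>
  Read a matrix as a weighted digraph on its index set, with an edge from \<open>i\<close> to \<open>j\<close> when the entry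
  \<open>(i, j)\<close> is nonzero.  Reducibility means that some nonempty proper set \<open>X\<close> of vertices has no edge
  leaving it (\<open>reducible_mat_iff_closed_set\<close>).  The principal minors detect this as follows.

  Call a permutation of \<open>S\<close> crossing if it maps some element of \<open>S \<inter> X\<close> outside \<open>X\<close>.  The terms of
  the Leibniz expansion on \<open>S\<close> that belong to noncrossing permutations always add up to the product
  of the minors on \<open>S \<inter> X\<close> and \<open>S - X\<close> (\<open>sum_noncrossing_perm_terms\<close>).  If no edge of \<open>B\<close> leaves
  \<open>X\<close>, the crossing terms of \<open>B\<close> vanish, so every principal minor of \<open>B\<close> is such a product.  If \<open>A\<close>
  has the same principal minors, the same product formula holds for \<open>A\<close>, which says that for every
  \<open>S\<close> the crossing terms of \<open>A\<close> add up to zero.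

  For irreducible \<open>A\<close> this fails for a suitable \<open>S\<close>.  Strong connectivity gives a directed cycle of
  \<open>A\<close> that contains an edge leaving \<open>X\<close>; take \<open>S\<close> to be the vertex set of a shortest one.  The only
  danger is that several crossing permutations of \<open>S\<close> have nonzero weight and cancel.  They cannot:
  write the cycle as \<open>f 0, \<dots>, f m\<close>, where the closing edge from \<open>f m\<close> to \<open>f 0\<close> is the one that leaves
  \<open>X\<close>.  An edge that jumps forward along this list would give a shorter cycle through the same closing
  edge.  A permutation without forward jumps that is not a cycle on all of \<open>S\<close> splits off a smaller
  crossing cycle, and otherwise it is forced to follow the list step by step
  (\<open>crossing_permutation_of_shortest_cycle\<close>).  So exactly one crossing term is nonzero.
\<close>

section \<open>Reducibility and sets that no edge leaves\<close>

definition closed_set :: "('i \<Rightarrow> 'i \<Rightarrow> 'a::zero) \<Rightarrow> 'i set \<Rightarrow> 'i set \<Rightarrow> bool" where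
  "closed_set a N X \<longleftrightarrow> (\<forall>i\<in>X. \<forall>j\<in>N - X. a i j = 0)"

text \<open>
  The rows of all diagonal blocks below the first one form a closed set.  Conversely, listing the
  complement of a closed set first and the closed set last gives a triangular form with two blocks,
  so more than two blocks never have to be considered.
\<close>

lemma reducible_mat_iff_closed_set:
  assumes A: "A \<in> carrier_mat n n"
  shows "reducible_mat A \<longleftrightarrow>
    (\<exists>X. X \<noteq> {} \<and> X \<subset> {0..<n} \<and> closed_set (\<lambda>i j. A $$ (i, j)) {0..<n} X)"
proof
  assume "reducible_mat A"
  then obtain p ds where p: "p permutes {0..<n}" and len: "length ds \<ge> 2"
    and but: "block_upper_triangular ds (mat n n (\<lambda>(i, j). A $$ (p i, p j)))"
    using A by (auto simp: reducible_mat_def)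
  from but have sum: "sum_list ds = n" and pos: "\<forall>d \<in> set ds. d > 0"
    by (auto simp: block_upper_triangular_def)
  obtain d ds' where ds: "ds = d # ds'" using len by (cases ds) auto
  then obtain e es where ds': "ds' = e # es" using len by (cases ds') auto
  have d: "0 < d" "d < n" using pos sum by (auto simp: ds ds')
  have zero: "A $$ (p i, p j) = 0" if "d \<le> i" "i < n" "j < d" for i j
  proof -
    have "\<exists>k \<le> length ds. j < sum_list (take k ds) \<and> sum_list (take k ds) \<le> i"
      using that by (intro exI[of _ 1]) (auto simp: ds)
    then have "mat n n (\<lambda>(i, j). A $$ (p i, p j)) $$ (i, j) = 0"
      using but that d by (auto simp: block_upper_triangular_def)
    then show ?thesis using that d by simp
  qed
  have "p ` {0..<n} = {0..<n}" using p by (rule permutes_image)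
  then have im: "p ` {d..<n} = {0..<n} - p ` {0..<d}"
  proof -
    have "{d..<n} = {0..<n} - {0..<d}" by auto
    then show ?thesis
      using p \<open>p ` {0..<n} = {0..<n}\<close> by (metis image_set_diff permutes_inj)
  qed
  have sub: "p ` {0..<d} \<subseteq> {0..<n}"
    using \<open>p ` {0..<n} = {0..<n}\<close> d by (metis image_mono ivl_subset le0 less_imp_le)
  show "\<exists>X. X \<noteq> {} \<and> X \<subset> {0..<n} \<and> closed_set (\<lambda>i j. A $$ (i, j)) {0..<n} X"
  proof (intro exI conjI)
    show "p ` {d..<n} \<noteq> {}" using d by simp
    have "p 0 \<in> p ` {0..<d}" using d by simp
    moreover from this have "p 0 \<in> {0..<n}" using sub by blast
    ultimately show "p ` {d..<n} \<subset> {0..<n}" unfolding im by blast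
    have "{0..<n} - p ` {d..<n} = p ` {0..<d}" unfolding im using sub by auto
    then show "closed_set (\<lambda>i j. A $$ (i, j)) {0..<n} (p ` {d..<n})"
      using zero by (auto simp: closed_set_def)
  qed
next
  assume "\<exists>X. X \<noteq> {} \<and> X \<subset> {0..<n} \<and> closed_set (\<lambda>i j. A $$ (i, j)) {0..<n} X"
  then obtain X where X: "X \<noteq> {}" "X \<subset> {0..<n}"
    and closed: "closed_set (\<lambda>i j. A $$ (i, j)) {0..<n} X" by blast
  have fin: "finite X" using X finite_subset by blast
  define e where "e = card X"
  have e: "0 < e" "e < n"
    using X fin psubset_card_mono[of "{0..<n}" X] by (auto simp: e_def card_gt_0_iff)
  define d where "d = n - e"
  have d: "0 < d" "d < n" "d + e = n" using e by (auto simp: d_def)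
  have "\<exists>g. bij_betw g {0..<d} ({0..<n} - X)"
    using X fin d by (intro finite_same_card_bij) (auto simp: card_Diff_subset d_def e_def)
  then obtain g where g: "bij_betw g {0..<d} ({0..<n} - X)" ..
  have "\<exists>h. bij_betw h {d..<n} X"
    using fin d by (intro finite_same_card_bij) (auto simp: e_def)
  then obtain h where h: "bij_betw h {d..<n} X" ..
  define p where "p = (\<lambda>i. if i < d then g i else if i < n then h i else i)"
  have pg: "bij_betw p {0..<d} ({0..<n} - X)"
    using g by (subst bij_betw_cong[of _ _ g]) (auto simp: p_def)
  have ph: "bij_betw p {d..<n} X"
    using h by (subst bij_betw_cong[of _ _ h]) (auto simp: p_def)
  have "bij_betw p ({0..<d} \<union> {d..<n}) (({0..<n} - X) \<union> X)"
    using pg ph by (rule bij_betw_combine) auto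
  moreover have "{0..<d} \<union> {d..<n} = {0..<n}" "({0..<n} - X) \<union> X = {0..<n}" using d X by auto
  ultimately have p: "p permutes {0..<n}" using d by (intro bij_imp_permutes) (auto simp: p_def)
  have zero: "A $$ (p i, p j) = 0" if "j < d" "d \<le> i" "i < n" for i j
    using closed bij_betwE[OF pg] bij_betwE[OF ph] that by (auto simp: closed_set_def)
  have "block_upper_triangular [d, e] (mat n n (\<lambda>(i, j). A $$ (p i, p j)))"
    unfolding block_upper_triangular_def
  proof (intro conjI allI impI)
    fix i j
    assume i: "i < dim_row (mat n n (\<lambda>(i, j). A $$ (p i, p j)))"
      and j: "j < dim_col (mat n n (\<lambda>(i, j). A $$ (p i, p j)))"
      and "\<exists>k \<le> length [d, e]. j < sum_list (take k [d, e]) \<and> sum_list (take k [d, e]) \<le> i"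
    then obtain k where k: "j < sum_list (take k [d, e])" "sum_list (take k [d, e]) \<le> i" by blast
    have "k = 1"
    proof (cases k)
      case (Suc k')
      then show ?thesis using k i d by (cases k') auto
    qed (use k in auto)
    then show "mat n n (\<lambda>(i, j). A $$ (p i, p j)) $$ (i, j) = 0" using zero k i j by auto
  qed (use d e in auto)
  then show "reducible_mat A"
    unfolding reducible_mat_def using A p
    by (intro conjI exI[of _ p] exI[of _ "[d, e]"]) auto
qed

section \<open>Leibniz expansion of principal minors\<close>

text \<open>
  Expanding over permutations of the index set \<open>S\<close> itself avoids renumbering the rows of a
  submatrix, so that expansions on different index sets can be compared directly.
\<close>

definition perm_term :: "('i \<Rightarrow> 'i \<Rightarrow> 'a::comm_ring_1) \<Rightarrow> 'i set \<Rightarrow> ('i \<Rightarrow> 'i) \<Rightarrow> 'a" where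
  "perm_term a S p = of_int (sign p) * (\<Prod>i\<in>S. a i (p i))"

definition leibniz_sum :: "('i \<Rightarrow> 'i \<Rightarrow> 'a::comm_ring_1) \<Rightarrow> 'i set \<Rightarrow> 'a" where
  "leibniz_sum a S = (\<Sum>p | p permutes S. perm_term a S p)"

text \<open>
  The increasing enumeration \<open>pick S\<close> conjugates permutations of \<open>{0..<card S}\<close> into permutations of
  \<open>S\<close>, and conjugation preserves the sign.
\<close>

lemma principal_minor_eq_leibniz_sum:
  assumes A: "A \<in> carrier_mat n n" and S: "S \<subseteq> {0..<n}"
  shows "principal_minor A S = leibniz_sum (\<lambda>i j. A $$ (i, j)) S"
proof -
  define k where "k = card S"
  have rows: "{i. i < n \<and> i \<in> S} = S" using S by auto
  have fin: "finite S" using S finite_subset by blast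
  have sub: "submatrix A S S = mat k k (\<lambda>(i, j). A $$ (pick S i, pick S j))"
    using A by (simp add: submatrix_def rows k_def)
  have inj: "inj_on (pick S) {0..<k}"
    by (rule linorder_inj_onI) (use pick_mono_le[of _ S] in \<open>fastforce simp: k_def\<close>)+
  have "pick S ` {0..<k} \<subseteq> S" using pick_in_set_le by (auto simp: k_def)
  then have "pick S ` {0..<k} = S"
    using fin inj by (intro card_subset_eq) (auto simp: card_image k_def)
  with inj have bij: "bij_betw (pick S) {0..<k} S" by (simp add: bij_betw_def)
  let ?T = "map_permutation {0..<k} (pick S)"
  let ?U = "map_permutation S (inv_into {0..<k} (pick S))"
  have bij': "bij_betw (inv_into {0..<k} (pick S)) S {0..<k}" by (rule bij_betw_inv_into[OF bij])
  have "det (submatrix A S S) = (\<Sum>p | p permutes {0..<k}.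
      of_int (sign p) * (\<Prod>i = 0..<k. A $$ (pick S i, pick S (p i))))"
    unfolding sub det_def
    by (auto intro!: sum.cong prod.cong simp: permutes_in_image[where S = "{0..<k}", simplified])
  also have "\<dots> = leibniz_sum (\<lambda>i j. A $$ (i, j)) S"
    unfolding leibniz_sum_def
  proof (rule sum.reindex_bij_witness[where i = ?U and j = ?T])
    fix p assume "p \<in> {p. p permutes {0..<k}}"
    then have p: "p permutes {0..<k}" by simp
    show "?U (?T p) = p"
      by (rule map_permutation_compose_inv[OF bij p]) (use inj in auto)
    show "?T p \<in> {p. p permutes S}" using map_permutation_permutes[OF bij p] by simp
    have "(\<Prod>i\<in>S. A $$ (i, ?T p i)) = (\<Prod>i = 0..<k. A $$ (pick S i, ?T p (pick S i)))"
      by (rule prod.reindex_bij_betw[OF bij, symmetric])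
    also have "\<dots> = (\<Prod>i = 0..<k. A $$ (pick S i, pick S (p i)))"
      by (intro prod.cong refl) (simp add: map_permutation_apply[OF inj])
    finally show "perm_term (\<lambda>i j. A $$ (i, j)) S (?T p) =
        of_int (sign p) * (\<Prod>i = 0..<k. A $$ (pick S i, pick S (p i)))"
      by (simp add: perm_term_def sign_map_permutation[OF inj p])
  next
    fix p assume "p \<in> {p. p permutes S}"
    then have p: "p permutes S" by simp
    show "?T (?U p) = p"
      by (rule map_permutation_compose_inv[OF bij' p]) (use bij in \<open>auto simp: bij_betw_def f_inv_into_f\<close>)
    show "?U p \<in> {p. p permutes {0..<k}}" using map_permutation_permutes[OF bij' p] by simp
  qed
  finally show ?thesis by (simp add: principal_minor_def)
qed

text \<open>
  By finiteness, a permutation of \<open>S\<close> that does not leave \<open>X\<close> from \<open>S \<inter> X\<close> preserves both \<open>S \<inter> X\<close> and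
  \<open>S - X\<close>; it is therefore a pair of independent permutations of the two parts, and signs and weights
  multiply.
\<close>

lemma sum_noncrossing_perm_terms:
  assumes fin: "finite S"
  shows "(\<Sum>p | p permutes S \<and> p ` (S \<inter> X) \<subseteq> X. perm_term a S p) =
    leibniz_sum a (S \<inter> X) * leibniz_sum a (S - X)"
proof -
  let ?I = "S \<inter> X" and ?J = "S - X"
  let ?split = "\<lambda>p. (restrict_id p ?I, restrict_id p ?J)"
  have finI: "finite ?I" "finite ?J" using fin by auto
  have "leibniz_sum a ?I * leibniz_sum a ?J =
      (\<Sum>(q, r) \<in> {q. q permutes ?I} \<times> {r. r permutes ?J}. perm_term a ?I q * perm_term a ?J r)"
    by (simp add: leibniz_sum_def sum_product sum.cartesian_product)
  also have "\<dots> = (\<Sum>p | p permutes S \<and> p ` ?I \<subseteq> X. perm_term a S p)"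
  proof (rule sum.reindex_bij_witness[where i = ?split and j = "\<lambda>(q, r). q \<circ> r"])
    fix z assume "z \<in> {q. q permutes ?I} \<times> {r. r permutes ?J}"
    then obtain q r where z: "z = (q, r)" and q: "q permutes ?I" and r: "r permutes ?J" by auto
    have qI: "q i \<in> ?I \<longleftrightarrow> i \<in> ?I" for i using q by (rule permutes_in_image)
    have rJ: "r i \<in> ?J \<longleftrightarrow> i \<in> ?J" for i using r by (rule permutes_in_image)
    have on_I: "(q \<circ> r) i = q i" if "i \<in> ?I" for i using that r by (simp add: permutes_not_in)
    have on_J: "(q \<circ> r) i = r i" if "i \<in> ?J" for i
      using that rJ[of i] q by (simp add: permutes_not_in)
    show "?split ((\<lambda>(q, r). q \<circ> r) z) = z"
      using on_I on_J q r by (auto simp: z restrict_id_def fun_eq_iff permutes_not_in)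
    have "q permutes S" "r permutes S" using q r by (auto intro: permutes_subset)
    then have "q \<circ> r permutes S" by (intro permutes_compose)
    then show "(\<lambda>(q, r). q \<circ> r) z \<in> {p. p permutes S \<and> p ` ?I \<subseteq> X}"
      using on_I qI by (auto simp: z simp del: o_apply)
    have "(\<Prod>i\<in>S. a i ((q \<circ> r) i)) = (\<Prod>i\<in>?I. a i ((q \<circ> r) i)) * (\<Prod>i\<in>?J. a i ((q \<circ> r) i))"
      using prod.Int_Diff[OF fin] by blast
    also have "\<dots> = (\<Prod>i\<in>?I. a i (q i)) * (\<Prod>i\<in>?J. a i (r i))"
      using on_I on_J by (intro arg_cong2[of _ _ _ _ "(*)"] prod.cong refl) auto
    finally show "perm_term a S ((\<lambda>(q, r). q \<circ> r) z) =
        (case z of (q, r) \<Rightarrow> perm_term a ?I q * perm_term a ?J r)"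
      using permutes_imp_permutation[OF finI(1) q] permutes_imp_permutation[OF finI(2) r]
      by (simp add: z perm_term_def sign_compose mult_ac)
  next
    fix p assume "p \<in> {p. p permutes S \<and> p ` ?I \<subseteq> X}"
    then have p: "p permutes S" and "p ` ?I \<subseteq> X" by auto
    then have pI: "p ` ?I \<subseteq> ?I" using permutes_in_image[OF p] by auto
    have inj: "inj p" using p by (rule permutes_inj)
    have pI': "p ` ?I = ?I"
      using pI inj finI by (intro endo_inj_surj) (auto intro: inj_on_subset)
    have "p ` ?J = p ` S - p ` ?I" using inj by (auto simp: inj_eq)
    then have pJ: "p ` ?J = ?J" using pI' permutes_image[OF p] by auto
    have "bij_betw p ?I ?I" "bij_betw p ?J ?J"
      using pI' pJ inj by (auto simp: bij_betw_def intro: inj_on_subset)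
    then show "?split p \<in> {q. q permutes ?I} \<times> {r. r permutes ?J}"
      by (auto intro: permutes_restrict_id)
    show "(\<lambda>(q, r). q \<circ> r) (?split p) = p"
      using pI' pJ permutes_not_in[OF p] by (auto simp: restrict_id_def fun_eq_iff)
  qed
  finally show ?thesis ..
qed

lemma leibniz_sum_split_if_closed_set:
  assumes S: "finite S" "S \<subseteq> N" and closed: "closed_set b N X"
  shows "leibniz_sum b S = leibniz_sum b (S \<inter> X) * leibniz_sum b (S - X)"
proof -
  have "leibniz_sum b S = (\<Sum>p | p permutes S \<and> p ` (S \<inter> X) \<subseteq> X. perm_term b S p)"
    unfolding leibniz_sum_def
  proof (rule sum.mono_neutral_right)
    show "\<forall>p \<in> {p. p permutes S} - {p. p permutes S \<and> p ` (S \<inter> X) \<subseteq> X}. perm_term b S p = 0"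
    proof
      fix p assume "p \<in> {p. p permutes S} - {p. p permutes S \<and> p ` (S \<inter> X) \<subseteq> X}"
      then obtain i where p: "p permutes S" and i: "i \<in> S" "i \<in> X" "p i \<notin> X" by auto
      have "p i \<in> N" using i p S by (auto simp: permutes_in_image)
      then have "b i (p i) = 0" using closed i by (auto simp: closed_set_def)
      then have "(\<Prod>i\<in>S. b i (p i)) = 0" using i S by (metis prod_zero)
      then show "perm_term b S p = 0" by (simp add: perm_term_def)
    qed
  qed (auto simp: finite_permutations S)
  then show ?thesis by (simp add: sum_noncrossing_perm_terms[OF S(1)])
qed

section \<open>Crossing cycles\<close>

text \<open>A shortest path repeats no vertex, since the detour between two visits could be cut out.\<close>

lemma injective_path:
  assumes "(x, y) \<in> E\<^sup>*"
  shows "\<exists>m f. inj_on f {..m::nat} \<and> f 0 = x \<and> f m = y \<and> (\<forall>k<m. (f k, f (Suc k)) \<in> E)"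
proof -
  have ex: "\<exists>m. (x, y) \<in> E ^^ m" using assms by (rule rtrancl_imp_relpow)
  define m where "m = (LEAST m. (x, y) \<in> E ^^ m)"
  have "(x, y) \<in> E ^^ m" unfolding m_def using ex by (rule LeastI_ex)
  then obtain f where f: "f 0 = x" "f m = y" and step: "\<forall>k<m. (f k, f (Suc k)) \<in> E"
    by (auto simp: relpow_fun_conv)
  have "f i \<noteq> f j" if "i < j" "j \<le> m" for i j
  proof
    assume eq: "f i = f j"
    have "(f 0, f i) \<in> E ^^ i" using step that by (auto simp: relpow_fun_conv intro!: exI[of _ f])
    moreover have "(f j, f m) \<in> E ^^ (m - j)"
      using step that by (auto simp: relpow_fun_conv intro!: exI[of _ "\<lambda>k. f (j + k)"])
    ultimately have "(x, y) \<in> E ^^ (i + (m - j))" using f eq by (auto simp: relpow_add)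
    then have "m \<le> i + (m - j)" unfolding m_def by (rule Least_le)
    then show False using that by simp
  qed
  then have "inj_on f {..m}" by (intro linorder_inj_onI) auto
  with f step show ?thesis by blast
qed

text \<open>
  Appending a vertex to a cycle is composition with one transposition, which redirects the closing
  edge to the new vertex.
\<close>

lemma cyclic_permutation:
  fixes f :: "nat \<Rightarrow> 'i"
  assumes "inj_on f {..m}"
  shows "\<exists>p. p permutes f ` {..m} \<and> (\<forall>k<m. p (f k) = f (Suc k)) \<and> p (f m) = f 0"
  using assms
proof (induction m)
  case 0
  show ?case by (intro exI[of _ id]) auto
next
  case (Suc m)
  then have "inj_on f {..m}" by (auto intro: inj_on_subset)
  with Suc.IH obtain p where p: "p permutes f ` {..m}" "\<forall>k<m. p (f k) = f (Suc k)" "p (f m) = f 0"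
    by blast
  have eq: "f i = f j \<longleftrightarrow> i = j" if "i \<le> Suc m" "j \<le> Suc m" for i j
    using Suc.prems that by (auto simp: inj_on_def)
  let ?t = "Transposition.transpose (f 0) (f (Suc m))"
  have "?t \<circ> p permutes f ` {..Suc m}"
    using p by (intro permutes_compose permutes_swap_id permutes_subset[OF p(1)]) auto
  moreover have "p (f (Suc m)) = f (Suc m)"
    using p(1) by (rule permutes_not_in) (auto simp: eq)
  moreover have "(?t \<circ> p) (f k) = f (Suc k)" if "k < Suc m" for k
    using that p by (cases "k = m") (auto simp: transpose_def eq)
  ultimately show ?case
    by (intro exI[of _ "?t \<circ> p"])
      (simp del: comp_apply add: comp_apply[of ?t p "f (Suc m)"])
qed

text \<open>
  The numbering starts right after an edge that leaves \<open>X\<close>: the closing edge from \<open>f m\<close> to \<open>f 0\<close> is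
  the crossing one.  A shortcut along \<open>f 0, \<dots>, f m\<close> then always keeps the cycle crossing.
\<close>

definition crossing_cycle ::
  "('i \<Rightarrow> 'i \<Rightarrow> 'a::zero) \<Rightarrow> 'i set \<Rightarrow> 'i set \<Rightarrow> nat \<Rightarrow> (nat \<Rightarrow> 'i) \<Rightarrow> bool" where
  "crossing_cycle a N X m f \<longleftrightarrow> inj_on f {..m} \<and> f ` {..m} \<subseteq> N \<and>
     (\<forall>k<m. a (f k) (f (Suc k)) \<noteq> 0) \<and> a (f m) (f 0) \<noteq> 0 \<and> f m \<in> X \<and> f 0 \<notin> X"

lemma crossing_cycle_of_return_path:
  assumes "(y, x) \<in> E\<^sup>*" and E: "\<And>u v. (u, v) \<in> E \<Longrightarrow> v \<in> N \<and> a u v \<noteq> 0"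
    and "y \<in> N" "a x y \<noteq> 0" "x \<in> X" "y \<notin> X"
  shows "\<exists>m f. crossing_cycle a N X m f"
proof -
  obtain m :: nat and f where f: "inj_on f {..m}" "f 0 = y" "f m = x"
    and step: "\<forall>k<m. (f k, f (Suc k)) \<in> E"
    using injective_path[OF assms(1)] by blast
  have "f k \<in> N" if "k \<le> m" for k
  proof (cases k)
    case (Suc i)
    then have "(f i, f (Suc i)) \<in> E" using step that by simp
    then show ?thesis using E Suc by blast
  qed (use f assms in simp)
  then show ?thesis
    using f step E assms by (intro exI[of _ m] exI[of _ f]) (auto simp: crossing_cycle_def)
qed

text \<open>
  The vertices reachable from the head of an edge that leaves \<open>X\<close> form a closed set, hence are all
  of \<open>N\<close>; so there is a path back to the tail.
\<close>

lemma irreducible_imp_crossing_cycle: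
  assumes irred: "\<And>R. R \<noteq> {} \<Longrightarrow> R \<subset> N \<Longrightarrow> \<not> closed_set a N R"
    and X: "X \<noteq> {}" "X \<subset> N"
  shows "\<exists>m f. crossing_cycle a N X m f"
proof -
  obtain x y where xy: "x \<in> X" "y \<in> N - X" "a x y \<noteq> 0"
    using irred[OF X] by (auto simp: closed_set_def)
  define E where "E = {(u, v). v \<in> N \<and> a u v \<noteq> 0}"
  have "E\<^sup>* `` {y} \<subseteq> N"
    using xy by (auto elim: rtranclE simp: E_def)
  moreover have "closed_set a N (E\<^sup>* `` {y})"
    by (auto simp: closed_set_def E_def intro: rtrancl_into_rtrancl)
  ultimately have "E\<^sup>* `` {y} = N"
    using irred[of "E\<^sup>* `` {y}"] by blast
  then have "(y, x) \<in> E\<^sup>*" using xy X by blast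
  then show ?thesis
    by (rule crossing_cycle_of_return_path) (use xy in \<open>auto simp: E_def\<close>)
qed

text \<open>
  This extracts from a crossing permutation the cycle through its crossing edge.  It is stated for an
  invariant subset \<open>T\<close>, so that it also bounds the length of that cycle when the permutation has
  smaller invariant sets.  The forward orbit of \<open>q x\<close> is mapped injectively into itself, hence onto
  itself, and so it contains the preimage \<open>x\<close> of \<open>q x\<close>.
\<close>

lemma crossing_permutation_imp_crossing_cycle:
  assumes fin: "finite T" and q: "inj_on q T" "q ` T \<subseteq> T" "\<And>u. u \<in> T \<Longrightarrow> a u (q u) \<noteq> 0"
    and x: "x \<in> T" "x \<in> X" "q x \<notin> X"
  shows "\<exists>m f. crossing_cycle a T X m f"
proof -
  define E where "E = {(u, q u) | u. u \<in> T}"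
  let ?R = "E\<^sup>* `` {q x}"
  have "v \<in> T" if "(q x, v) \<in> E\<^sup>*" for v
    using that by induction (use x q in \<open>auto simp: E_def\<close>)
  then have sub: "?R \<subseteq> T" by auto
  have "(q x, q v) \<in> E\<^sup>*" if "(q x, v) \<in> E\<^sup>*" for v
  proof -
    have "(v, q v) \<in> E" using that sub by (auto simp: E_def)
    with that show ?thesis by (rule rtrancl_into_rtrancl)
  qed
  then have "q ` ?R \<subseteq> ?R" by auto
  then have "q ` ?R = ?R"
    using sub fin q by (intro endo_inj_surj) (auto intro: inj_on_subset finite_subset)
  then have "q x \<in> q ` ?R" by auto
  then have "x \<in> ?R" using q(1) sub x by (auto dest: inj_onD)
  then have "(q x, x) \<in> E\<^sup>*" by simp
  then show ?thesis
    by (rule crossing_cycle_of_return_path) (use q x in \<open>auto simp: E_def\<close>)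
qed

lemma crossing_cycle_length_less_card:
  assumes "crossing_cycle a T X m f" "finite T"
  shows "m < card T"
  using assms card_mono[of T "f ` {..m}"] by (auto simp: crossing_cycle_def card_image)

lemma crossing_cycle_shortcut:
  assumes f: "crossing_cycle a N X m f" and rs: "r < s" "s \<le> m" and "a (f r) (f s) \<noteq> 0"
  shows "\<exists>g. crossing_cycle a N X (m - (s - Suc r)) g"
proof -
  define g where "g = (\<lambda>k. f (if k \<le> r then k else k + (s - Suc r)))"
  let ?m = "m - (s - Suc r)"
  define \<sigma> where "\<sigma> = (\<lambda>k. if k \<le> r then k else k + (s - Suc r))"
  have "inj_on \<sigma> {..?m}" "\<sigma> ` {..?m} \<subseteq> {..m}"
    using rs by (auto simp: \<sigma>_def inj_on_def)
  then have "inj_on (f \<circ> \<sigma>) {..?m}"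
    using f by (intro comp_inj_on) (auto simp: crossing_cycle_def intro: inj_on_subset)
  then have "inj_on g {..?m}" by (simp add: g_def \<sigma>_def comp_def)
  moreover have "g ` {..?m} \<subseteq> f ` {..m}"
    using rs by (auto simp: g_def)
  moreover have "a (g k) (g (Suc k)) \<noteq> 0" if "k < ?m" for k
  proof (cases "k = r")
    case True
    then show ?thesis using assms by (simp add: g_def)
  next
    case False
    then show ?thesis using f that by (auto simp: g_def crossing_cycle_def)
  qed
  moreover have "g 0 = f 0" "g ?m = f m"
    using rs by (auto simp: g_def)
  ultimately show ?thesis
    using f by (intro exI[of _ g]) (auto simp: crossing_cycle_def)
qed

section \<open>No cancellation on a shortest crossing cycle\<close>

text \<open>
  By induction along the cycle, \<open>q\<close> has to send \<open>f k\<close> to \<open>f (Suc k)\<close> for \<open>k < m\<close>: a later vertex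
  would be a shortcut, an earlier one other than \<open>f 0\<close> is already the image of its predecessor, and
  \<open>f 0\<close> would close up the initial segment into a proper invariant set, leaving a shorter crossing
  cycle inside that segment or inside its complement.
\<close>

lemma crossing_permutation_of_shortest_cycle:
  assumes f: "crossing_cycle a N X m f"
    and shortest: "\<forall>m' g. crossing_cycle a N X m' g \<longrightarrow> m \<le> m'"
    and q: "q permutes f ` {..m}" "\<And>u. u \<in> f ` {..m} \<Longrightarrow> a u (q u) \<noteq> 0"
    and x: "x \<in> f ` {..m}" "x \<in> X" "q x \<notin> X"
  shows "(\<forall>k<m. q (f k) = f (Suc k)) \<and> q (f m) = f 0"
proof -
  let ?S = "f ` {..m}"
  have inj: "inj_on f {..m}" and SN: "?S \<subseteq> N" using f by (auto simp: crossing_cycle_def)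
  have injq: "inj q" using q(1) by (rule permutes_inj)
  have qS: "q ` ?S = ?S" using q(1) by (rule permutes_image)
  \<comment> \<open>A proper invariant set around the crossing point would contain a crossing cycle that is too short.\<close>
  have no_proper: "T = ?S" if "T \<subseteq> ?S" "q ` T \<subseteq> T" "x \<in> T" for T
  proof (rule ccontr)
    assume "T \<noteq> ?S"
    with that have "card T < card ?S" by (intro psubset_card_mono) auto
    moreover have fin: "finite T" using that finite_subset by blast
    have "inj_on q T" using injq by (rule inj_on_subset) simp
    have "\<exists>m' g. crossing_cycle a T X m' g"
      by (rule crossing_permutation_imp_crossing_cycle[where q = q and x = x])
        (use fin that q x \<open>inj_on q T\<close> in auto)
    then obtain m' g where g: "crossing_cycle a T X m' g" by blast
    then have "crossing_cycle a N X m' g" using subset_trans[OF that(1) SN] by (auto simp: crossing_cycle_def)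
    then have "m \<le> m'" using shortest by blast
    moreover have "m' < card T" using g fin by (rule crossing_cycle_length_less_card)
    ultimately show False using inj by (simp add: card_image)
  qed
  have step: "q (f k) = f (Suc k)" if "k < m" for k
    using that
  proof (induction k rule: less_induct)
    case (less k)
    have "q (f k) \<in> ?S" using qS less.prems by auto
    then obtain s where s: "s \<le> m" "q (f k) = f s" by auto
    have "s \<noteq> 0"
    proof
      assume "s = 0"
      let ?T = "f ` {..k}"
      have T: "?T \<subseteq> ?S" using less.prems by auto
      have "q (f i) \<in> ?T" if "i \<le> k" for i
        using that less \<open>s = 0\<close> s by (cases "i = k") auto
      then have "q ` ?T \<subseteq> ?T" by auto
      moreover from this have "q ` ?T = ?T"
        using injq by (intro endo_inj_surj) (auto intro: inj_on_subset)
      then have "q ` (?S - ?T) \<subseteq> ?S - ?T"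
        using qS injq by (metis image_set_diff order_refl)
      ultimately have "?T = ?S \<or> ?S - ?T = ?S"
        using no_proper[of ?T] no_proper[of "?S - ?T"] T x by blast
      moreover have "f m \<notin> ?T"
        using inj_on_image_mem_iff[OF inj, of m "{..k}"] less.prems by auto
      then have "f m \<in> ?S - ?T" "f 0 \<in> ?T" by auto
      ultimately show False by blast
    qed
    have "\<not> s \<le> k"
    proof
      assume "s \<le> k"
      with \<open>s \<noteq> 0\<close> less have "q (f (s - 1)) = f s" by simp
      then have "f (s - 1) = f k" using s injq by (metis injD)
      then have "s - 1 = k"
        by (rule inj_onD[OF inj]) (use \<open>s \<le> k\<close> less.prems in auto)
      then show False using \<open>s \<le> k\<close> \<open>s \<noteq> 0\<close> by linarith
    qed
    moreover have "\<not> Suc k < s"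
    proof
      assume "Suc k < s"
      have "a (f k) (f s) \<noteq> 0" using q(2)[of "f k"] s less.prems by auto
      then obtain g where "crossing_cycle a N X (m - (s - Suc k)) g"
        using crossing_cycle_shortcut[OF f] s \<open>Suc k < s\<close> by (meson Suc_lessD)
      then have "m \<le> m - (s - Suc k)" using shortest by blast
      then show False using s \<open>Suc k < s\<close> by linarith
    qed
    ultimately have "s = Suc k" by simp
    then show ?case using s by simp
  qed
  \<comment> \<open>All other vertices are taken as images, so only \<open>f 0\<close> is left for \<open>f m\<close>.\<close>
  have "q (f m) \<in> ?S" using qS by auto
  then obtain s where s: "s \<le> m" "q (f m) = f s" by auto
  have "s = 0"
  proof (rule ccontr)
    assume "s \<noteq> 0"
    with s step[of "s - 1"] have "q (f (s - 1)) = f s" by simp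
    then have "f (s - 1) = f m" using s injq by (metis injD)
    then have "s - 1 = m"
      by (rule inj_onD[OF inj]) (use s in auto)
    then show False using s \<open>s \<noteq> 0\<close> by linarith
  qed
  with s step show ?thesis by auto
qed

text \<open>
  The two sides differ by the sum of the crossing terms, which consists of the single nonzero term of
  the cycle itself.  Absence of zero divisors makes the weight of the cycle nonzero.
\<close>

lemma leibniz_sum_not_split_on_shortest_crossing_cycle:
  fixes a :: "'i \<Rightarrow> 'i \<Rightarrow> 'a::idom"
  assumes f: "crossing_cycle a N X m f"
    and shortest: "\<forall>m' g. crossing_cycle a N X m' g \<longrightarrow> m \<le> m'"
  defines "S \<equiv> f ` {..m}"
  shows "leibniz_sum a S \<noteq> leibniz_sum a (S \<inter> X) * leibniz_sum a (S - X)"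
proof -
  have inj: "inj_on f {..m}" using f by (simp add: crossing_cycle_def)
  then obtain c where c: "c permutes S" "\<forall>k<m. c (f k) = f (Suc k)" "c (f m) = f 0"
    using cyclic_permutation S_def by metis
  have fin: "finite S" by (simp add: S_def)
  let ?P = "{p. p permutes S}"
  let ?Q = "{p. p permutes S \<and> p ` (S \<inter> X) \<subseteq> X}"
  have weight: "a u (c u) \<noteq> 0" if u: "u \<in> S" for u
  proof -
    from u obtain k where "k \<le> m" "u = f k" by (auto simp: S_def)
    then show ?thesis using c f by (cases "k = m") (auto simp: crossing_cycle_def)
  qed
  have "c (f m) \<notin> X" "f m \<in> S \<inter> X" using c f by (auto simp: crossing_cycle_def S_def)
  then have "c \<in> ?P - ?Q" using c by blast
  moreover have "perm_term a S q = 0" if "q \<in> ?P - ?Q - {c}" for q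
  proof (rule ccontr)
    assume nz: "perm_term a S q \<noteq> 0"
    have q: "q permutes S" and "\<not> q ` (S \<inter> X) \<subseteq> X" using that by auto
    then obtain x where x: "x \<in> S" "x \<in> X" "q x \<notin> X" by blast
    have "a u (q u) \<noteq> 0" if "u \<in> S" for u
      using nz that fin by (auto simp: perm_term_def)
    then have cyc: "(\<forall>k<m. q (f k) = f (Suc k)) \<and> q (f m) = f 0"
      using crossing_permutation_of_shortest_cycle[OF f shortest] q x unfolding S_def by blast
    have "q u = c u" for u
    proof (cases "u \<in> S")
      case True
      then obtain k where "k \<le> m" "u = f k" by (auto simp: S_def)
      then show ?thesis using c cyc by (cases "k = m") auto
    qed (use q c in \<open>simp add: permutes_not_in\<close>)
    then show False using that by auto
  qed
  ultimately have "(\<Sum>p \<in> ?P - ?Q. perm_term a S p) = perm_term a S c"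
    using fin by (subst sum.remove[of _ c]) (auto simp: finite_permutations)
  also have "\<dots> \<noteq> 0"
    using weight fin by (cases c rule: sign_cases) (auto simp: perm_term_def)
  finally have "(\<Sum>p \<in> ?P - ?Q. perm_term a S p) \<noteq> 0" .
  moreover have "leibniz_sum a S = (\<Sum>p \<in> ?P - ?Q. perm_term a S p) + (\<Sum>p \<in> ?Q. perm_term a S p)"
    unfolding leibniz_sum_def by (rule sum.subset_diff) (auto simp: finite_permutations fin)
  ultimately show ?thesis
    by (simp add: sum_noncrossing_perm_terms[OF fin])
qed

section \<open>Fibers of irreducible matrices\<close>

theorem corollary5p6:
  fixes A :: "'a::field mat" and n :: nat
  assumes "n \<ge> 4"
    and "A \<in> carrier_mat n n"
    and "irreducible_mat A"
  shows "\<forall>B \<in> fiber n A. irreducible_mat B"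
proof (rule ballI, rule ccontr)
  let ?N = "{0..<n}"
  let ?a = "\<lambda>i j. A $$ (i, j)"
  fix B assume "B \<in> fiber n A" and nirr: "\<not> irreducible_mat B"
  then have B: "B \<in> carrier_mat n n"
    and minors: "\<And>S. S \<subseteq> ?N \<Longrightarrow> principal_minor B S = principal_minor A S"
    by (auto simp: fiber_def)
  let ?b = "\<lambda>i j. B $$ (i, j)"
  have eq: "leibniz_sum ?a S = leibniz_sum ?b S" if "S \<subseteq> ?N" for S
    using minors[OF that] principal_minor_eq_leibniz_sum[OF B that]
      principal_minor_eq_leibniz_sum[OF assms(2) that] by simp
  have "reducible_mat B" using nirr B by (auto simp: irreducible_mat_def)
  then obtain X where X: "X \<noteq> {}" "X \<subset> ?N" and closed: "closed_set ?b ?N X"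
    using reducible_mat_iff_closed_set[OF B] by blast
  have "\<exists>m f. crossing_cycle ?a ?N X m f"
    using assms(3) X reducible_mat_iff_closed_set[OF assms(2)]
    by (intro irreducible_imp_crossing_cycle) (auto simp: irreducible_mat_def)
  then obtain m f where f: "crossing_cycle ?a ?N X m f"
    and shortest: "\<forall>m' g. crossing_cycle ?a ?N X m' g \<longrightarrow> m \<le> m'"
    using exists_least_iff[of "\<lambda>m. \<exists>f. crossing_cycle ?a ?N X m f"] by (meson not_less)
  define S where "S = f ` {..m}"
  have S: "S \<subseteq> ?N" "finite S" using f by (auto simp: crossing_cycle_def S_def)
  then have "S \<inter> X \<subseteq> ?N" "S - X \<subseteq> ?N" by auto
  with eq S have "leibniz_sum ?a S = leibniz_sum ?a (S \<inter> X) * leibniz_sum ?a (S - X)"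
    using leibniz_sum_split_if_closed_set[OF S(2) S(1) closed] by simp
  then show False
    using leibniz_sum_not_split_on_shortest_crossing_cycle[OF f shortest] S_def by blast
qed

end
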